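(* Let $G$ be a graph with $v(G)\le 4$. Then $G$ is $\mathcal{S}_5$-contractible if and only if one of the following holds: (1) $v(G)=2$ and $e(G)\ge 4$ (equivalently, $G=aK_2$ with $a\ge 4$); (2) $v(G)=3$, $e(G)\ge 8$ and $\delta(G)\ge 4$ (equivalently, $G=T_{a,b,c}$ with $a+b+c\ge 8$ and $\min\{a+b,a+c,b+c\}\ge 4$); (3) $v(G)=4$ and $G$ has a spanning subgraph $G'$ with $e(G')\ge 12$, $\delta(G')\ge 4$, $\mu(G')\le 4$, and $G'$ not isomorphic to $W_1$ or $W_2$.
   Context: Graphs are finite and may have parallel edges but no loops; $v(G)=|V(G)|$, $e(G)=|E(G)|$, $\delta(G)$ is the minimum degree, $\mu(G)$ is the maximum number of parallel edges between any pair of vertices. For $X\subseteq V(G)$, $d(X)$ is the number of edges with exactly one endpoint in $X$. A vertex partition $\mathcal{P}=\{V_1,\dots,V_t\}$ of $G$ is a partition of $V(G)$ into nonempty parts; $G/\mathcal{P}$ is obtained by identifying the vertices of each part into a single vertex and deleting resulting loops. $w_G(\mathcal{P})=\sum_{i=1}^t d(V_i)-10t+16$, and $w(G)$ is the minimum of $w_G(\mathcal{P})$ over all vertex partitions of $G$ with at least two parts. $aK_2$ is two vertices joined by $a$ parallel edges; $T_{a,b,c}$ is three vertices whose three pairs are joined by $a,b,c$ parallel edges; $W_1$ has vertices $x,y_1,y_2,y_3$ with $\mu(x,y_i)=3$ and $\mu(y_i,y_j)=1$; $W_2$ has vertices $p,q,r,s$ with $\mu(p,q)=3$, $\mu(r,s)=1$,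 $\mu(p,r)=\mu(p,s)=\mu(q,r)=\mu(q,s)=2$. Let $\mathcal{N}_5=\{2K_2,3K_2,T_{1,3,3},T_{2,2,3},W_1,W_2\}$. A connected graph $G$ with $v(G)\ge 2$ is $\mathcal{S}_5$-contractible if $w(G)\ge0$ and for every vertex partition $\mathcal{P}$ of $G$, $G/\mathcal{P}$ is not isomorphic to a member of $\mathcal{N}_5$. *)

theory Defs
  imports Main "HOL-Library.Multiset" "HOL-Library.Disjoint_Sets"
begin

text \<open>
  An edge is the two-element set of its endpoints; parallel edges are repeated elements of
  the multiset of edges.
\<close>

record 'a mgraph =
  verts :: "'a set"
  edges :: "'a set multiset"

definition multigraph :: "'a mgraph \<Rightarrow> bool" where
  "multigraph G \<longleftrightarrow> finite (verts G) \<and> (\<forall>e \<in># edges G. e \<subseteq> verts G \<and> card e = 2)"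

definition num_verts :: "'a mgraph \<Rightarrow> nat" where
  "num_verts G = card (verts G)"

definition num_edges :: "'a mgraph \<Rightarrow> nat" where
  "num_edges G = size (edges G)"

definition vdegree :: "'a mgraph \<Rightarrow> 'a \<Rightarrow> nat" where
  "vdegree G v = size {#e \<in># edges G. v \<in> e#}"

text \<open>Only meaningful if there is at least one vertex.\<close>

definition min_degree :: "'a mgraph \<Rightarrow> nat" where
  "min_degree G = Min (vdegree G ` verts G)"

definition multiplicity :: "'a mgraph \<Rightarrow> 'a \<Rightarrow> 'a \<Rightarrow> nat" where
  "multiplicity G u v = count (edges G) {u, v}"

text \<open>Only meaningful if there are at least two vertices.\<close>

definition max_multiplicity :: "'a mgraph \<Rightarrow> nat" where
  "max_multiplicity G =
     Max {multiplicity G u v | u v. u \<in> verts G \<and> v \<in> verts G \<and> u \<noteq> v}"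

text \<open>The number of edges with exactly one endpoint in \<open>X\<close>.\<close>

definition cut_degree :: "'a mgraph \<Rightarrow> 'a set \<Rightarrow> nat" where
  "cut_degree G X = size {#e \<in># edges G. card (e \<inter> X) = 1#}"

definition connected_mgraph :: "'a mgraph \<Rightarrow> bool" where
  "connected_mgraph G \<longleftrightarrow> verts G \<noteq> {} \<and>
     (\<forall>u \<in> verts G. \<forall>v \<in> verts G. (u, v) \<in> {(x, y). {x, y} \<in># edges G}\<^sup>*)"

definition spanning_subgraph :: "'a mgraph \<Rightarrow> 'a mgraph \<Rightarrow> bool" where
  "spanning_subgraph H G \<longleftrightarrow> verts H = verts G \<and> edges H \<subseteq># edges G"

definition isomorphic :: "'a mgraph \<Rightarrow> 'b mgraph \<Rightarrow> bool" where
  "isomorphic G H \<longleftrightarrow>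
     (\<exists>f. bij_betw f (verts G) (verts H) \<and> image_mset (image f) (edges G) = edges H)"

text \<open>
  The vertices of \<open>G/\<P>\<close> are the parts themselves. An edge becomes the set of the parts that it
  meets, which is a singleton exactly if the edge has become a loop.
\<close>

definition contract :: "'a mgraph \<Rightarrow> 'a set set \<Rightarrow> 'a set mgraph" where
  "contract G P =
     \<lparr>verts = P,
      edges = {#F \<in># image_mset (\<lambda>e. {X \<in> P. X \<inter> e \<noteq> {}}) (edges G). card F = 2#}\<rparr>"

definition partition_weight :: "'a mgraph \<Rightarrow> 'a set set \<Rightarrow> int" where
  "partition_weight G P = (\<Sum>X \<in> P. int (cut_degree G X)) - 10 * int (card P) + 16"

text \<open>Only meaningful if there are at least two vertices.\<close>

definition weight :: "'a mgraph \<Rightarrow> int" where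
  "weight G = Min (partition_weight G ` {P. partition_on (verts G) P \<and> 2 \<le> card P})"

definition multi_K2 :: "nat \<Rightarrow> nat mgraph" where
  "multi_K2 a = \<lparr>verts = {0, 1}, edges = replicate_mset a {0, 1}\<rparr>"

definition multi_triangle :: "nat \<Rightarrow> nat \<Rightarrow> nat \<Rightarrow> nat mgraph" where
  "multi_triangle a b c =
     \<lparr>verts = {0, 1, 2},
      edges = replicate_mset a {0, 1} + replicate_mset b {0, 2} + replicate_mset c {1, 2}\<rparr>"

text \<open>\<open>x = 0\<close> and \<open>y\<^sub>i = i\<close>.\<close>

definition W1 :: "nat mgraph" where
  "W1 =
     \<lparr>verts = {0, 1, 2, 3},
      edges = replicate_mset 3 {0, 1} + replicate_mset 3 {0, 2} + replicate_mset 3 {0, 3}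
        + {#{1, 2}, {1, 3}, {2, 3}#}\<rparr>"

text \<open>\<open>p = 0\<close>, \<open>q = 1\<close>, \<open>r = 2\<close> and \<open>s = 3\<close>.\<close>

definition W2 :: "nat mgraph" where
  "W2 =
     \<lparr>verts = {0, 1, 2, 3},
      edges = replicate_mset 3 {0, 1} + {#{2, 3}#}
        + replicate_mset 2 {0, 2} + replicate_mset 2 {0, 3}
        + replicate_mset 2 {1, 2} + replicate_mset 2 {1, 3}\<rparr>"

definition N5 :: "nat mgraph set" where
  "N5 = {multi_K2 2, multi_K2 3, multi_triangle 1 3 3, multi_triangle 2 2 3, W1, W2}"

definition S5_contractible :: "'a mgraph \<Rightarrow> bool" where
  "S5_contractible G \<longleftrightarrow>
     connected_mgraph G \<and> 2 \<le> num_verts G \<and> 0 \<le> weight G \<and>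
     (\<forall>P. partition_on (verts G) P \<longrightarrow> \<not> (\<exists>H \<in> N5. isomorphic (contract G P) H))"

end

theory Submission
  imports Defs
begin

text \<open>
  The degrees of \<open>G/\<P>\<close> are the cut degrees of the parts, so \<open>w\<^sub>G(\<P>) = 2 e(G/\<P>) - 10 t + 16\<close>.
  Hence a graph on at most four vertices is contractible iff every cut has at least 4 edges, every
  contraction to three vertices has at least 8 edges and, if there are four vertices, there are at
  least 12 edges and the graph is neither \<open>W1\<close> nor \<open>W2\<close>. On four vertices, replacing every
  multiplicity by its minimum with 4 preserves these conditions. Conversely, if all multiplicities
  are at most 4, then 12 edges and minimum degree 4 imply them: contracting a pair loses at most 4
  edges, and a cut into two pairs misses at most 8. All conditions but the exclusion of \<open>W1\<close> and
  \<open>W2\<close> pass to supergraphs, and these two graphs have exactly 12 edges.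
\<close>

section \<open>Isomorphism and degrees\<close>

lemma multigraphD:
  assumes "multigraph G"
  shows "finite (verts G)"
    and "e \<in># edges G \<Longrightarrow> e \<subseteq> verts G"
    and "e \<in># edges G \<Longrightarrow> card e = 2"
  using assms unfolding multigraph_def by auto

lemma isomorphic_num_verts: "isomorphic G H \<Longrightarrow> num_verts G = num_verts H"
  unfolding isomorphic_def num_verts_def using bij_betw_same_card by blast

lemma isomorphic_num_edges: "isomorphic G H \<Longrightarrow> num_edges G = num_edges H"
  unfolding isomorphic_def num_edges_def by (metis size_image_mset)

text \<open>The inverse of \<open>f\<close> undoes it only on \<open>verts G\<close>, so the
  argument needs every edge to be a subset of \<open>verts G\<close>; this is what
  \<open>multigraph G\<close> provides.\<close>

lemma isomorphic_sym:
  assumes "multigraph G" "isomorphic G H"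
  shows "isomorphic H G"
proof -
  obtain f where f: "bij_betw f (verts G) (verts H)" "image_mset (image f) (edges G) = edges H"
    using assms(2) unfolding isomorphic_def by blast
  define g where "g = inv_into (verts G) f"
  have "g ` f ` e = e" if "e \<in># edges G" for e
    using multigraphD(2)[OF assms(1) that] f(1) unfolding g_def
    by (metis bij_betw_imp_inj_on inv_into_image_cancel)
  then have "image_mset (image g) (edges H) = edges G"
    unfolding f(2)[symmetric] by (simp add: multiset.map_comp multiset.map_ident_strong comp_def)
  moreover have "bij_betw g (verts H) (verts G)"
    unfolding g_def using f(1) bij_betw_inv_into by blast
  ultimately show ?thesis unfolding isomorphic_def by blast
qed

lemma isomorphic_trans:
  assumes "isomorphic G H" "isomorphic H K"
  shows "isomorphic G K"
proof -
  obtain f g where fg: "bij_betw f (verts G) (verts H)" "image_mset (image f) (edges G) = edges H"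
    "bij_betw g (verts H) (verts K)" "image_mset (image g) (edges H) = edges K"
    using assms unfolding isomorphic_def by blast
  have "image_mset (image (g \<circ> f)) (edges G) = edges K"
    unfolding fg(2)[symmetric] fg(4)[symmetric]
    by (simp add: multiset.map_comp image_comp[symmetric] comp_def image_image)
  with bij_betw_trans[OF fg(1,3)] show ?thesis
    unfolding isomorphic_def by blast
qed

lemma isomorphic_min_degree:
  assumes "multigraph G" "isomorphic G H"
  shows "min_degree G = min_degree H"
proof -
  obtain f where f: "bij_betw f (verts G) (verts H)" "image_mset (image f) (edges G) = edges H"
    using assms(2) unfolding isomorphic_def by blast
  have "vdegree H (f v) = vdegree G v" if v: "v \<in> verts G" for v
  proof -
    have "f v \<in> f ` e \<longleftrightarrow> v \<in> e" if "e \<in># edges G" for e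
      using multigraphD(2)[OF assms(1) that] f(1) v
      by (meson bij_betw_imp_inj_on inj_on_image_mem_iff)
    then have "filter_mset (\<lambda>e. f v \<in> f ` e) (edges G) = filter_mset (\<lambda>e. v \<in> e) (edges G)"
      by (rule filter_mset_cong0)
    then show ?thesis
      unfolding vdegree_def f(2)[symmetric] by (simp add: filter_mset_image_mset)
  qed
  then have "vdegree H ` f ` verts G = vdegree G ` verts G"
    by (simp add: image_image)
  then show ?thesis
    using f(1) unfolding min_degree_def by (simp add: bij_betw_imp_surj_on)
qed

text \<open>Serves to carry an upper bound on all multiplicities from \<open>H\<close> back to
  \<open>G\<close>. The image of \<open>e\<close> under \<open>f\<close> collects the copies of
  \<open>e\<close>, so an inequality needs no injectivity.\<close>

lemma isomorphic_count_le:
  assumes "isomorphic G H"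
  shows "\<exists>e'. count (edges G) e \<le> count (edges H) e'"
proof -
  obtain f where f: "image_mset (image f) (edges G) = edges H"
    using assms unfolding isomorphic_def by blast
  have "count (edges G) e \<le> count (edges H) (f ` e)"
  proof (cases "e \<in># edges G")
    case True
    then show ?thesis
      unfolding f[symmetric] count_image_mset by (intro member_le_sum) auto
  qed (simp add: not_in_iff)
  then show ?thesis by blast
qed

lemma handshake:
  assumes "multigraph G"
  shows "(\<Sum>v\<in>verts G. vdegree G v) = 2 * num_edges G"
proof -
  \<comment> \<open>Fixing \<open>V\<close> and letting the edge multiset vary makes induction on
    the edges possible: each new edge raises exactly two of the summands by one.\<close>
  have "(\<Sum>v\<in>V. size {#e \<in># M. v \<in> e#}) = 2 * size M"
    if "finite V" "\<forall>e\<in>#M. e \<subseteq> V \<and> card e = 2" for V :: "'a set" and M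
    using that(2)
  proof (induction M)
    case (add e M)
    have "size {#e' \<in># add_mset e M. v \<in> e'#} = of_bool (v \<in> e) + size {#e' \<in># M. v \<in> e'#}" for v
      by simp
    moreover have "(\<Sum>v\<in>V. of_bool (v \<in> e)) = (2::nat)"
      using add.prems \<open>finite V\<close> by (simp add: Int_absorb1 Int_commute)
    ultimately show ?case using add by (simp add: sum.distrib del: filter_mset_add_mset)
  qed simp
  then show ?thesis
    using assms unfolding multigraph_def vdegree_def num_edges_def by blast
qed

text \<open>\<open>A\<close> may exceed the support, so that it can be a fixed list of all
  conceivable edges; those that do not occur contribute 0.\<close>

lemma size_filter_mset_sum:
  assumes "finite A" "set_mset M \<subseteq> A"
  shows "size (filter_mset Q M) = (\<Sum>x\<in>A. if Q x then count M x else 0)"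
proof -
  have "size (filter_mset Q M) = (\<Sum>x\<in>set_mset (filter_mset Q M). count (filter_mset Q M) x)"
    by (simp add: size_multiset_overloaded_eq)
  also have "\<dots> = (\<Sum>x\<in>A. count (filter_mset Q M) x)"
    using assms by (intro sum.mono_neutral_left) (auto simp: not_in_iff)
  finally show ?thesis by simp
qed

lemma multiset_eq_sum_replicate:
  assumes "finite A" "set_mset M \<subseteq> A"
  shows "M = (\<Sum>x\<in>A. replicate_mset (count M x) x)"
proof (rule multiset_eqI)
  fix x
  show "count M x = count (\<Sum>x\<in>A. replicate_mset (count M x) x) x"
    using assms by (auto simp: count_sum not_in_iff)
qed

section \<open>Graphs on two and three vertices, and invariants of the members of
  \<open>N5\<close>\<close>

lemma two_vertices:
  assumes "multigraph G" "verts G = {u, v}" "u \<noteq> v"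
  shows "edges G = replicate_mset (num_edges G) {u, v}"
proof -
  have "e = {u, v}" if "e \<in># edges G" for e
    using card_subset_eq[OF multigraphD(1)[OF assms(1)] multigraphD(2)[OF assms(1) that]] multigraphD(3)[OF assms(1) that]
      assms(2,3) by simp
  then have "set_mset (edges G) \<subseteq> {{u, v}}" by blast
  then show ?thesis
    using set_mset_subset_singletonD unfolding num_edges_def by fastforce
qed

lemma isomorphic_multi_K2:
  assumes "multigraph G" "num_verts G = 2"
  shows "isomorphic G (multi_K2 (num_edges G))"
proof -
  obtain u v where uv: "verts G = {u, v}" "u \<noteq> v"
    using assms(2) unfolding num_verts_def card_2_iff by blast
  let ?f = "\<lambda>x. if x = u then 0 else 1 :: nat"
  have "bij_betw ?f (verts G) {0, 1}"
    using uv unfolding bij_betw_def inj_on_def by auto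
  moreover have "image_mset (image ?f) (edges G) = replicate_mset (num_edges G) {0, 1}"
    by (subst two_vertices[OF assms(1) uv]) (use uv in \<open>simp add: insert_commute\<close>)
  ultimately show ?thesis
    unfolding isomorphic_def multi_K2_def by auto
qed

text \<open>Every edge is the whole vertex set, so each vertex meets all edges.\<close>

lemma vdegree_two_vertices:
  assumes "multigraph G" "num_verts G = 2" "v \<in> verts G"
  shows "vdegree G v = num_edges G"
proof -
  have "v \<in> e" if "e \<in># edges G" for e
    using card_subset_eq[OF multigraphD(1)[OF assms(1)] multigraphD(2)[OF assms(1) that]] multigraphD(1,3)[OF assms(1)] that
      assms(2,3) unfolding num_verts_def by simp
  then have "filter_mset (\<lambda>e. v \<in> e) (edges G) = filter_mset (\<lambda>e. True) (edges G)"
    by (intro filter_mset_cong0) simp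
  then show ?thesis
    unfolding vdegree_def num_edges_def by simp
qed

lemma three_vertices:
  assumes "multigraph G" "verts G = {u, v, w}" "u \<noteq> v" "v \<noteq> w" "u \<noteq> w"
  shows "set_mset (edges G) \<subseteq> {{u, v}, {u, w}, {v, w}}"
proof
  fix e assume e: "e \<in># edges G"
  then obtain x y where xy: "e = {x, y}" "x \<noteq> y"
    using multigraphD(3)[OF assms(1) e] unfolding card_2_iff by blast
  have "x \<in> {u, v, w}" "y \<in> {u, v, w}"
    using multigraphD(2)[OF assms(1) e] unfolding assms(2) xy(1) by blast+
  with xy(2) show "e \<in> {{u, v}, {u, w}, {v, w}}"
    unfolding xy(1) by (auto simp: doubleton_eq_iff)
qed

lemma isomorphic_multi_triangle:
  assumes "multigraph G" "num_verts G = 3"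
  obtains a b c where "isomorphic G (multi_triangle a b c)"
proof -
  obtain u v w where V: "verts G = {u, v, w}" "u \<noteq> v" "v \<noteq> w" "u \<noteq> w"
    using assms(2) unfolding num_verts_def card_3_iff by blast
  let ?a = "count (edges G) {u, v}" and ?b = "count (edges G) {u, w}"
    and ?c = "count (edges G) {v, w}"
  have "edges G = (\<Sum>x\<in>{{u, v}, {u, w}, {v, w}}. replicate_mset (count (edges G) x) x)"
    by (intro multiset_eq_sum_replicate three_vertices assms V) simp
  also have "\<dots> = replicate_mset ?a {u, v} + replicate_mset ?b {u, w} + replicate_mset ?c {v, w}"
    using V by (simp add: doubleton_eq_iff add.assoc)
  finally have E: "edges G = replicate_mset ?a {u, v} + replicate_mset ?b {u, w} + replicate_mset ?c {v, w}" .
  let ?f = "\<lambda>x. if x = u then 0 else if x = v then 1 else 2 :: nat"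
  have "bij_betw ?f (verts G) {0, 1, 2}"
    using V unfolding bij_betw_def inj_on_def by auto
  moreover have "image_mset (image ?f) (edges G)
      = replicate_mset ?a {0, 1} + replicate_mset ?b {0, 2} + replicate_mset ?c {1, 2}"
    by (subst E) (use V in \<open>simp add: insert_commute\<close>)
  ultimately have "isomorphic G (multi_triangle ?a ?b ?c)"
    unfolding isomorphic_def multi_triangle_def by auto
  then show thesis by (rule that)
qed

lemma multi_triangle_stats:
  "num_verts (multi_triangle a b c) = 3"
  "num_edges (multi_triangle a b c) = a + b + c"
  "min_degree (multi_triangle a b c) = Min {a + b, a + c, b + c}"
proof -
  show "num_verts (multi_triangle a b c) = 3" "num_edges (multi_triangle a b c) = a + b + c"
    by (simp_all add: num_verts_def num_edges_def multi_triangle_def)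
  have "filter_mset Q (replicate_mset n x) = (if Q x then replicate_mset n x else {#})" 
    for Q n and x :: "nat set"
    by (induction n) auto
  then have "vdegree (multi_triangle a b c) 0 = a + b" "vdegree (multi_triangle a b c) 1 = a + c"
    "vdegree (multi_triangle a b c) 2 = b + c"
    by (auto simp: vdegree_def multi_triangle_def)
  then show "min_degree (multi_triangle a b c) = Min {a + b, a + c, b + c}"
    unfolding min_degree_def by (simp add: multi_triangle_def numeral_2_eq_2)
qed

lemma multi_K2_stats:
  "num_verts (multi_K2 a) = 2" "num_edges (multi_K2 a) = a"
  by (simp_all add: num_verts_def num_edges_def multi_K2_def)

lemma W_stats:
  "num_verts W1 = 4" "num_verts W2 = 4" "num_edges W1 = 12" "num_edges W2 = 12"
  by (simp_all add: num_verts_def num_edges_def W1_def W2_def)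

lemma count_W_le: "count (edges W1) e \<le> 3" "count (edges W2) e \<le> 3"
  by (auto simp: W1_def W2_def doubleton_eq_iff)

text \<open>With seven edges and every degree at least 4, each multiplicity is at most 3, which leaves
  only \<open>1, 3, 3\<close> and \<open>2, 2, 3\<close>.\<close>

lemma isomorphic_triangle_7:
  assumes G: "multigraph G" "num_verts G = 3" and "num_edges G = 7" "min_degree G \<ge> 4"
  shows "isomorphic G (multi_triangle 1 3 3) \<or> isomorphic G (multi_triangle 2 2 3)"
proof -
  obtain a b c where abc: "isomorphic G (multi_triangle a b c)"
    using isomorphic_multi_triangle[OF G] .
  have "a + b + c = 7" "a + b \<ge> 4" "a + c \<ge> 4" "b + c \<ge> 4"
    using isomorphic_num_edges[OF abc] isomorphic_min_degree[OF G(1) abc] assms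
    by (simp_all add: multi_triangle_stats)
  then have "(a, b, c) \<in> {(1, 3, 3), (3, 1, 3), (3, 3, 1), (2, 2, 3), (2, 3, 2), (3, 2, 2)}"
    by (simp; presburger)
  \<comment> \<open>Exchanging the vertices 1 and 2 swaps \<open>a\<close> and \<open>b\<close>;
    exchanging 0 and 1 swaps \<open>b\<close> and \<open>c\<close>. These two transpositions
    generate all permutations of the three multiplicities.\<close>
  moreover have "isomorphic (multi_triangle a b c) (multi_triangle b a c)" for a b c
    unfolding isomorphic_def
    by (rule exI[of _ "(\<lambda>x. if x = 1 then 2 else if x = 2 then 1 else x)"])
      (auto simp: multi_triangle_def bij_betw_def inj_on_def insert_commute)
  moreover have "isomorphic (multi_triangle a b c) (multi_triangle a c b)" for a b c
    unfolding isomorphic_def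
    by (rule exI[of _ "(\<lambda>x. if x = 0 then 1 else if x = 1 then 0 else x)"])
      (auto simp: multi_triangle_def bij_betw_def inj_on_def insert_commute)
  ultimately show ?thesis
    using abc isomorphic_trans by (smt (verit) insertE prod.inject singletonD)
qed

section \<open>Contractions and cuts\<close>

text \<open>Each endpoint of \<open>e\<close> lies in exactly one part. If these parts are
  \<open>A\<close> and \<open>B\<close>, then \<open>e\<close> becomes \<open>{A, B}\<close>, which
  is a loop exactly if \<open>A = B\<close>.\<close>

lemma
  assumes "multigraph G" "partition_on (verts G) P" "e \<in># edges G"
  shows card_contracted_edge: "card {X \<in> P. X \<inter> e \<noteq> {}} = 2 \<longleftrightarrow> (\<forall>X\<in>P. \<not> e \<subseteq> X)"
    and mem_contracted_edge: "X \<in> P \<Longrightarrow>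
      card {X \<in> P. X \<inter> e \<noteq> {}} = 2 \<and> X \<in> {X \<in> P. X \<inter> e \<noteq> {}} \<longleftrightarrow> card (e \<inter> X) = 1"
proof -
  obtain u v where e: "e = {u, v}" "u \<noteq> v"
    using multigraphD(3)[OF assms(1,3)] unfolding card_2_iff by blast
  have "u \<in> \<Union>P" "v \<in> \<Union>P"
    using multigraphD(2)[OF assms(1,3)] partition_onD1[OF assms(2)] unfolding e by auto
  then obtain A B where AB: "A \<in> P" "B \<in> P" "u \<in> A" "v \<in> B" by blast
  have u: "u \<in> Z \<longleftrightarrow> Z = A" and v: "v \<in> Z \<longleftrightarrow> Z = B" if "Z \<in> P" for Z
    using that AB disjointD[OF partition_onD2[OF assms(2)], of Z] by blast+
  have F: "{X \<in> P. X \<inter> e \<noteq> {}} = {A, B}"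
    using AB u v unfolding e(1) by fastforce
  have AB': "card {A, B} = 2 \<longleftrightarrow> A \<noteq> B" by (cases "A = B") auto
  show "card {X \<in> P. X \<inter> e \<noteq> {}} = 2 \<longleftrightarrow> (\<forall>X\<in>P. \<not> e \<subseteq> X)"
    unfolding F AB' using AB u v unfolding e(1) by auto
  show "card {X \<in> P. X \<inter> e \<noteq> {}} = 2 \<and> X \<in> {X \<in> P. X \<inter> e \<noteq> {}} \<longleftrightarrow> card (e \<inter> X) = 1"
    if X: "X \<in> P"
  proof -
    \<comment> \<open>The value is 1 exactly if \<open>X\<close> is one of \<open>A\<close> and
      \<open>B\<close> but not both, that is, if \<open>e\<close> survives as an edge at
      \<open>X\<close>.\<close>
    have "card (e \<inter> X) = of_bool (X = A) + of_bool (X = B)"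
      using e(2) u[OF X] v[OF X] unfolding e(1) by (auto simp: Int_insert_left)
    then show ?thesis unfolding F AB' by auto
  qed
qed

lemma multigraph_contract:
  assumes "multigraph G" "partition_on (verts G) P"
  shows "multigraph (contract G P)"
  using finite_elements[OF multigraphD(1)[OF assms(1)] assms(2)]
  unfolding multigraph_def contract_def by auto

lemma num_verts_contract: "num_verts (contract G P) = card P"
  unfolding num_verts_def contract_def by simp

lemma num_edges_contract:
  assumes "multigraph G" "partition_on (verts G) P"
  shows "num_edges (contract G P) = size {#e \<in># edges G. \<forall>X\<in>P. \<not> e \<subseteq> X#}"
proof -
  have "{#e \<in># edges G. card {X \<in> P. X \<inter> e \<noteq> {}} = 2#} = {#e \<in># edges G. \<forall>X\<in>P. \<not> e \<subseteq> X#}"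
    using card_contracted_edge[OF assms] by (intro filter_mset_cong0)
  then show ?thesis
    unfolding num_edges_def contract_def by (simp add: filter_mset_image_mset)
qed

lemma vdegree_contract:
  assumes "multigraph G" "partition_on (verts G) P" "X \<in> P"
  shows "vdegree (contract G P) X = cut_degree G X"
proof -
  let ?g = "\<lambda>e. {X \<in> P. X \<inter> e \<noteq> {}}"
  have "{#e \<in># edges G. card (?g e) = 2 \<and> X \<in> ?g e#} = {#e \<in># edges G. card (e \<inter> X) = 1#}"
    using mem_contracted_edge[OF assms(1,2) _ assms(3)] by (intro filter_mset_cong0)
  then have "vdegree (contract G P) X = size {#e \<in># edges G. card (e \<inter> X) = 1#}"
    unfolding vdegree_def contract_def
    by (simp add: filter_mset_image_mset filter_filter_mset conj_commute del: mem_Collect_eq)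
  then show ?thesis unfolding cut_degree_def .
qed

lemma partition_weight_eq:
  assumes "multigraph G" "partition_on (verts G) P"
  shows "partition_weight G P = 2 * int (num_edges (contract G P)) - 10 * int (card P) + 16"
proof -
  have "(\<Sum>X\<in>P. cut_degree G X) = 2 * num_edges (contract G P)"
    using handshake[OF multigraph_contract[OF assms]] vdegree_contract[OF assms]
    by (simp add: contract_def)
  then show ?thesis
    unfolding partition_weight_def by (simp flip: of_nat_sum)
qed

section \<open>Sizes of parts, and the partition into single vertices\<close>

lemma partition_card_sum:
  assumes "finite V" "partition_on V P"
  shows "(\<Sum>X\<in>P. card X) = card V"
  using assms finite_elements[OF assms] partition_onD1[OF assms(2)] partition_onD2[OF assms(2)]
  by (metis Sup_upper card_Union_disjoint finite_subset)

lemma partition_part: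
  assumes "finite V" "partition_on V P" "X \<in> P"
  shows "X \<subseteq> V" "finite X" "1 \<le> card X"
proof -
  show "X \<subseteq> V" using partition_onD1[OF assms(2)] assms(3) by blast
  then show "finite X" using assms(1) finite_subset by blast
  then show "1 \<le> card X"
    using partition_onD3[OF assms(2)] assms(3) by (metis One_nat_def Suc_leI card_gt_0_iff)
qed

lemma partition_card_le:
  assumes "finite V" "partition_on V P"
  shows "card P \<le> card V"
proof -
  have "(\<Sum>X\<in>P. 1) \<le> (\<Sum>X\<in>P. card X)"
    using partition_part(3)[OF assms] by (intro sum_mono)
  then show ?thesis using partition_card_sum[OF assms] by simp
qed

text \<open>The part sizes are at least 1 and sum to the number of parts, so each of them is
  1.\<close>

lemma partition_card_eq:
  assumes "finite V" "partition_on V P" "card P = card V"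
  shows "P = (\<lambda>v. {v}) ` V"
proof (rule card_subset_eq)
  have fin: "finite P" using finite_elements[OF assms(1,2)] .
  have sum: "(\<Sum>X\<in>P. card X) = (\<Sum>X\<in>P. 1)"
    using partition_card_sum[OF assms(1,2)] assms(3) by simp
  have "card X = 1" if "X \<in> P" for X
    using sum_mono_inv[OF sum[symmetric] _ that fin] partition_part(3)[OF assms(1,2)] by simp
  then show "P \<subseteq> (\<lambda>v. {v}) ` V"
    using partition_part(1)[OF assms(1,2)] by (force simp: card_1_singleton_iff)
qed (use assms in \<open>simp_all add: card_image\<close>)

lemma partition_part_psubset:
  assumes "partition_on V P" "2 \<le> card P" "X \<in> P"
  shows "X \<noteq> {}" "X \<subset> V"
proof -
  have "P \<noteq> {X}" using assms(2) by auto
  then obtain Y where Y: "Y \<in> P" "Y \<noteq> X" using assms(3) by blast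
  then have "Y \<noteq> {}" "X \<inter> Y = {}"
    using assms(1,3) unfolding partition_on_def by (auto dest: disjointD)
  then show "X \<subset> V" using Y assms(1,3) unfolding partition_on_def by blast
  show "X \<noteq> {}" using assms unfolding partition_on_def by blast
qed

text \<open>The trivial contraction has singletons as vertices, so it agrees with \<open>G\<close>
  only up to renaming. This turns conditions on contractions into conditions on \<open>G\<close>
  itself.\<close>

lemma isomorphic_contract_singletons:
  assumes "multigraph G"
  shows "isomorphic G (contract G ((\<lambda>v. {v}) ` verts G))"
proof -
  let ?P = "(\<lambda>v. {v}) ` verts G"
  have e: "{X \<in> ?P. X \<inter> e \<noteq> {}} = (\<lambda>v. {v}) ` e" if "e \<in># edges G" for e
    using multigraphD(2)[OF assms that] by auto
  then have "image_mset (\<lambda>e. {X \<in> ?P. X \<inter> e \<noteq> {}}) (edges G)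
      = image_mset (image (\<lambda>v. {v})) (edges G)"
    by (intro image_mset_cong)
  moreover have "{#F \<in># image_mset (image (\<lambda>v. {v})) (edges G). card F = 2#}
      = image_mset (image (\<lambda>v. {v})) (edges G)"
    using multigraphD(3)[OF assms] by (simp add: filter_mset_eq_conv card_image)
  ultimately have "edges (contract G ?P) = image_mset (image (\<lambda>v. {v})) (edges G)"
    unfolding contract_def by simp
  then show ?thesis
    unfolding isomorphic_def contract_def by (intro exI[of _ "\<lambda>v. {v}"]) (simp add: bij_betw_def)
qed

lemma partition_split:
  assumes "X \<noteq> {}" "X \<subset> V"
  shows "partition_on V {X, V - X}" "card {X, V - X} = 2"
proof -
  have "X \<noteq> V - X" "V - X \<noteq> {}" using assms by auto
  then show "partition_on V {X, V - X}" "card {X, V - X} = 2"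
    using assms unfolding partition_on_def disjoint_def by auto
qed

section \<open>Cuts, weight and connectivity\<close>

lemma vdegree_eq_cut_degree: "vdegree G v = cut_degree G {v}"
proof -
  have "card (e \<inter> {v}) = 1 \<longleftrightarrow> v \<in> e" for e by (cases "v \<in> e") auto
  then show ?thesis unfolding vdegree_def cut_degree_def by simp
qed

lemma min_degree_ge_iff:
  assumes "multigraph G" "verts G \<noteq> {}"
  shows "k \<le> min_degree G \<longleftrightarrow> (\<forall>v\<in>verts G. k \<le> vdegree G v)"
  using assms multigraphD(1)[OF assms(1)] unfolding min_degree_def by simp

text \<open>Contracting both sides of the cut leaves two vertices, whose degrees are the two cut
  degrees and both equal the number of remaining edges.\<close>

lemma cut_degree_split:
  assumes "multigraph G" "X \<noteq> {}" "X \<subset> verts G"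
  shows "num_edges (contract G {X, verts G - X}) = cut_degree G X"
    and "cut_degree G (verts G - X) = cut_degree G X"
proof -
  let ?P = "{X, verts G - X}"
  note P = partition_split[OF assms(2,3)]
  have "vdegree (contract G ?P) Y = num_edges (contract G ?P)" if "Y \<in> ?P" for Y
    using that P(2)
    by (intro vdegree_two_vertices[OF multigraph_contract[OF assms(1) P(1)]])
      (simp_all add: num_verts_contract, simp_all add: contract_def)
  then show "num_edges (contract G {X, verts G - X}) = cut_degree G X"
    and "cut_degree G (verts G - X) = cut_degree G X"
    using vdegree_contract[OF assms(1) P(1)] by auto
qed

text \<open>Halving \<open>2 e - 10 t + 16 \<ge> 0\<close> gives \<open>e \<ge> 5 t - 8\<close>;
  moving the 8 to the other side avoids subtraction on natural numbers.\<close>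

lemma weight_nonneg_iff:
  assumes "multigraph G" "2 \<le> num_verts G"
  shows "0 \<le> weight G \<longleftrightarrow>
    (\<forall>P. partition_on (verts G) P \<longrightarrow> 2 \<le> card P \<longrightarrow> 5 * card P \<le> num_edges (contract G P) + 8)"
proof -
  let ?S = "{P. partition_on (verts G) P \<and> 2 \<le> card P}"
  have "finite ?S"
    using finitely_many_partition_on[OF multigraphD(1)[OF assms(1)]] by simp
  \<comment> \<open>The partition into single vertices shows that the minimum ranges over a nonempty
    set.\<close>
  moreover have "(\<lambda>v. {v}) ` verts G \<in> ?S"
    using assms(2) by (simp add: partition_on_singletons card_image num_verts_def)
  ultimately have "0 \<le> weight G \<longleftrightarrow> (\<forall>P\<in>?S. 0 \<le> partition_weight G P)"
    unfolding weight_def by (subst Min_ge_iff) auto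
  moreover have "0 \<le> partition_weight G P \<longleftrightarrow> 5 * card P \<le> num_edges (contract G P) + 8"
    if "partition_on (verts G) P" for P
    using partition_weight_eq[OF assms(1) that] by linarith
  ultimately show ?thesis by auto
qed

text \<open>No edge leaves the set \<open>C\<close> of vertices reachable from \<open>u\<close>,
  since its other end would be reachable too. Hence \<open>C\<close> cannot be a proper subset of
  the vertices.\<close>

lemma connected_if_cut_degree_pos:
  assumes G: "multigraph G" and V: "verts G \<noteq> {}"
    and cut: "\<And>X. X \<noteq> {} \<Longrightarrow> X \<subset> verts G \<Longrightarrow> 0 < cut_degree G X"
  shows "connected_mgraph G"
  unfolding connected_mgraph_def
proof (intro conjI ballI V)
  fix u v assume uv: "u \<in> verts G" "v \<in> verts G"
  let ?R = "{(x, y). {x, y} \<in># edges G}"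
  define C where "C = {y \<in> verts G. (u, y) \<in> ?R\<^sup>*}"
  have "C = verts G"
  proof (rule ccontr)
    assume "C \<noteq> verts G"
    then have "C \<subset> verts G" unfolding C_def by blast
    moreover have "C \<noteq> {}" using uv unfolding C_def by blast
    ultimately obtain e where e: "e \<in># edges G" "card (e \<inter> C) = 1"
      using cut[of C] unfolding cut_degree_def by (auto simp: filter_mset_eq_conv simp flip: neq0_conv)
    obtain x where x: "e \<inter> C = {x}" by (rule card_1_singletonE[OF e(2)])
    obtain p q where pq: "e = {p, q}" "p \<noteq> q"
      using multigraphD(3)[OF G e(1)] unfolding card_2_iff by blast
    have xC: "x \<in> e" "x \<in> C" using x by auto
    then have "x = p \<or> x = q" unfolding pq(1) by simp
    then obtain y where y: "e = {x, y}" "y \<noteq> x"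
      using pq by (metis insert_commute)
    then have "y \<notin> C" using x by blast
    moreover have "(u, y) \<in> ?R\<^sup>*"
      using xC(2) e(1) rtrancl.rtrancl_into_rtrancl[of u x ?R y] unfolding y(1) C_def by simp
    moreover have "y \<in> verts G"
      using multigraphD(2)[OF G e(1)] unfolding y(1) by simp
    ultimately show False unfolding C_def by simp
  qed
  then show "(u, v) \<in> ?R\<^sup>*" using uv unfolding C_def by blast
qed

text \<open>For \<open>2\<close>, \<open>3\<close>, \<open>4\<close> parts, nonnegative weight means at least 2, 7, 12 edges in \<open>G/\<P>\<close>. The
  members of \<open>N5\<close> on two vertices raise the first bound to 4. All degrees of \<open>G/\<P>\<close> are then at
  least 4, so that the triangles in \<open>N5\<close> are all the possibilities with 7 edges.\<close>

lemma S5_contractible_iff: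
  assumes G: "multigraph G" and le4: "num_verts G \<le> 4"
  shows "S5_contractible G \<longleftrightarrow> 2 \<le> num_verts G \<and>
    (\<forall>X. X \<noteq> {} \<longrightarrow> X \<subset> verts G \<longrightarrow> 4 \<le> cut_degree G X) \<and>
    (\<forall>P. partition_on (verts G) P \<longrightarrow> card P = 3 \<longrightarrow> 8 \<le> num_edges (contract G P)) \<and>
    (num_verts G = 4 \<longrightarrow> 12 \<le> num_edges G \<and> \<not> isomorphic G W1 \<and> \<not> isomorphic G W2)"
    (is "_ \<longleftrightarrow> _ \<and> ?cuts \<and> ?triples \<and> ?whole")
proof
  assume S: "S5_contractible G"
  then have two: "2 \<le> num_verts G"
    and bound: "\<And>P. partition_on (verts G) P \<Longrightarrow> 2 \<le> card P \<Longrightarrow> 5 * card P \<le> num_edges (contract G P) + 8"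
    and notN5: "\<And>P H. partition_on (verts G) P \<Longrightarrow> H \<in> N5 \<Longrightarrow> \<not> isomorphic (contract G P) H"
    using weight_nonneg_iff[OF G] unfolding S5_contractible_def by blast+
  have cuts: ?cuts
  proof (intro allI impI)
    fix X assume X: "X \<noteq> {}" "X \<subset> verts G"
    let ?P = "{X, verts G - X}"
    note P = partition_split[OF X]
    have "isomorphic (contract G ?P) (multi_K2 (cut_degree G X))"
      using isomorphic_multi_K2[OF multigraph_contract[OF G P(1)]] P(2) cut_degree_split(1)[OF G X]
      by (simp add: num_verts_contract)
    then have "multi_K2 (cut_degree G X) \<notin> N5"
      using notN5[OF P(1)] by blast
    then have "cut_degree G X \<noteq> 2" "cut_degree G X \<noteq> 3"
      unfolding N5_def by auto
    moreover have "2 \<le> cut_degree G X"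
      using bound[OF P(1)] P(2) cut_degree_split(1)[OF G X] by simp
    ultimately show "4 \<le> cut_degree G X" by simp
  qed
  have triples: ?triples
  proof (intro allI impI)
    fix P assume P: "partition_on (verts G) P" "card P = 3"
    note GP = multigraph_contract[OF G P(1)]
    have "4 \<le> min_degree (contract G P)"
    proof (subst min_degree_ge_iff[OF GP])
      show "verts (contract G P) \<noteq> {}" using P(2) by (auto simp: contract_def)
      show "\<forall>X\<in>verts (contract G P). 4 \<le> vdegree (contract G P) X"
        using vdegree_contract[OF G P(1)] cuts partition_part_psubset[OF P(1)] P(2)
        by (simp add: contract_def)
    qed
    moreover have "multi_triangle 1 3 3 \<in> N5" "multi_triangle 2 2 3 \<in> N5"
      unfolding N5_def by simp_all
    then have "\<not> isomorphic (contract G P) (multi_triangle 1 3 3)"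
      "\<not> isomorphic (contract G P) (multi_triangle 2 2 3)"
      using notN5[OF P(1)] by blast+
    ultimately have "num_edges (contract G P) \<noteq> 7"
      using isomorphic_triangle_7[OF GP] P(2) num_verts_contract by metis
    moreover have "7 \<le> num_edges (contract G P)" using bound[OF P(1)] P(2) by simp
    ultimately show "8 \<le> num_edges (contract G P)" by simp
  qed
  have ?whole
  proof (intro impI)
    assume 4: "num_verts G = 4"
    let ?P = "(\<lambda>v. {v}) ` verts G"
    note P = partition_on_singletons[of "verts G"]
    note iso = isomorphic_contract_singletons[OF G]
    have "card ?P = 4" using 4 by (simp add: card_image num_verts_def)
    then have "12 \<le> num_edges G"
      using bound[OF P] isomorphic_num_edges[OF iso] by simp
    moreover have "\<not> isomorphic G H" if "H \<in> N5" for H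
      using notN5[OF P that] isomorphic_trans[OF isomorphic_sym[OF G iso]] by blast
    ultimately show "12 \<le> num_edges G \<and> \<not> isomorphic G W1 \<and> \<not> isomorphic G W2"
      unfolding N5_def by simp
  qed
  with two cuts triples show "2 \<le> num_verts G \<and> ?cuts \<and> ?triples \<and> ?whole" by blast
next
  assume R: "2 \<le> num_verts G \<and> ?cuts \<and> ?triples \<and> ?whole"
  note fin = multigraphD(1)[OF G]
  have V: "verts G \<noteq> {}" using R by (auto simp: num_verts_def)
  have "connected_mgraph G"
    using R by (intro connected_if_cut_degree_pos[OF G V]) (metis gr0I not_numeral_le_zero)
  \<comment> \<open>With at most four vertices, four parts can only be single vertices of a
    four-vertex graph, so this contraction is \<open>G\<close> up to isomorphism.\<close>
  have whole: "num_verts G = 4" "isomorphic G (contract G P)" "num_edges (contract G P) = num_edges G"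
    if P: "partition_on (verts G) P" "card P = 4" for P
  proof -
    show 4: "num_verts G = 4"
      using partition_card_le[OF fin P(1)] P(2) le4 by (simp add: num_verts_def)
    then have "P = (\<lambda>v. {v}) ` verts G"
      using partition_card_eq[OF fin P(1)] P(2) by (simp add: num_verts_def)
    then show "isomorphic G (contract G P)" using isomorphic_contract_singletons[OF G] by simp
    then show "num_edges (contract G P) = num_edges G" using isomorphic_num_edges by metis
  qed
  have two: "4 \<le> num_edges (contract G P)" if P: "partition_on (verts G) P" "card P = 2" for P
  proof -
    obtain X where X: "X \<in> P" using P(2) by fastforce
    have "num_edges (contract G P) = cut_degree G X"
      using vdegree_contract[OF G P(1) X] vdegree_two_vertices[OF multigraph_contract[OF G P(1)]] X P(2)
      by (simp add: num_verts_contract) (simp add: contract_def)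
    then show ?thesis using R partition_part_psubset[OF P(1) _ X] P(2) by simp
  qed
  have small: "card P = 2 \<or> card P = 3 \<or> card P = 4"
    if "partition_on (verts G) P" "2 \<le> card P" for P
    using partition_card_le[OF fin that(1)] that(2) le4 unfolding num_verts_def by linarith
  have "5 * card P \<le> num_edges (contract G P) + 8"
    if P: "partition_on (verts G) P" "2 \<le> card P" for P
    using small[OF P] two[OF P(1)] whole[OF P(1)] R P(1) by auto
  then have "0 \<le> weight G" using weight_nonneg_iff[OF G] R by blast
  moreover have "\<not> isomorphic (contract G P) H"
    if P: "partition_on (verts G) P" and H: "H \<in> N5" for P H
  proof
    assume iso: "isomorphic (contract G P) H"
    note n = isomorphic_num_verts[OF iso, unfolded num_verts_contract]
    note m = isomorphic_num_edges[OF iso]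
    \<comment> \<open>The number of vertices of \<open>H\<close> fixes \<open>card P\<close>. The
      first two kinds have fewer edges than the bounds 4 and 8 allow, and the third kind would make
      \<open>G\<close> itself isomorphic to \<open>W1\<close> or \<open>W2\<close>.\<close>
    from H consider a where "H = multi_K2 a" "a \<in> {2, 3}"
      | a b c where "H = multi_triangle a b c" "a + b + c = 7" | "H = W1 \<or> H = W2"
      unfolding N5_def by force
    then show False
    proof cases
      case 1
      then show ?thesis using n m two[OF P] by (auto simp: multi_K2_stats)
    next
      case 2
      then show ?thesis using n m R P by (auto simp: multi_triangle_stats)
    next
      case 3
      then have "card P = 4" using n W_stats by auto
      then show ?thesis
        using whole[OF P] isomorphic_trans[OF _ iso] 3 R by auto
    qed
  qed
  ultimately show "S5_contractible G"
    using R \<open>connected_mgraph G\<close> unfolding S5_contractible_def by blast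
qed

section \<open>Graphs with at most four vertices\<close>

text \<open>An edge inside a part with at most two vertices equals that part. The lost edges are
  therefore counted by the multiplicities of the parts, where single vertices contribute 0.\<close>

lemma num_edges_contract_small_parts:
  assumes "multigraph G" "partition_on (verts G) P" "\<And>X. X \<in> P \<Longrightarrow> card X \<le> 2"
  shows "num_edges G = num_edges (contract G P) + (\<Sum>X\<in>P. count (edges G) X)"
proof -
  note fin = finite_elements[OF multigraphD(1)[OF assms(1)] assms(2)]
  have inside: "(\<forall>X\<in>P. \<not> e \<subseteq> X) \<longleftrightarrow> e \<notin> P" if "e \<in># edges G" for e
  proof -
    have "e = X" if "X \<in> P" "e \<subseteq> X" for X
      using card_seteq[OF _ that(2)] multigraphD(3)[OF assms(1) \<open>e \<in># edges G\<close>] assms(3)[OF that(1)]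
        partition_part(2)[OF multigraphD(1)[OF assms(1)] assms(2) that(1)] by simp
    then show ?thesis by blast
  qed
  \<comment> \<open>The index set includes \<open>P\<close> because a part need not occur as an
    edge; afterwards the sum is restricted to \<open>P\<close>.\<close>
  have "size {#e \<in># edges G. e \<in> P#}
      = (\<Sum>x\<in>set_mset (edges G) \<union> P. if x \<in> P then count (edges G) x else 0)"
    using fin by (intro size_filter_mset_sum) auto
  also have "\<dots> = (\<Sum>X\<in>P. count (edges G) X)"
    using fin by (intro sum.mono_neutral_cong_right) auto
  finally have "size {#e \<in># edges G. e \<in> P#} = (\<Sum>X\<in>P. count (edges G) X)" .
  moreover have "num_edges (contract G P) = size {#e \<in># edges G. e \<notin> P#}"
    unfolding num_edges_contract[OF assms(1,2)]
    by (intro arg_cong[where f = size] filter_mset_cong0 inside)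
  moreover have "num_edges G = size {#e \<in># edges G. e \<in> P#} + size {#e \<in># edges G. e \<notin> P#}"
    unfolding num_edges_def by (metis multiset_partition size_union)
  ultimately show ?thesis by simp
qed

lemma count_edges_eq_0: "multigraph G \<Longrightarrow> card e \<noteq> 2 \<Longrightarrow> count (edges G) e = 0"
  by (metis multigraphD(3) not_in_iff)

text \<open>Two vertices make the set under \<open>Max\<close> nonempty. A set \<open>e\<close> that
  is not an edge has count 0, so quantifying over all sets adds no constraint.\<close>

lemma max_multiplicity_le_iff:
  assumes "multigraph G" "2 \<le> num_verts G"
  shows "max_multiplicity G \<le> k \<longleftrightarrow> (\<forall>e. count (edges G) e \<le> k)"
proof -
  let ?S = "{multiplicity G u v | u v. u \<in> verts G \<and> v \<in> verts G \<and> u \<noteq> v}"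
  have "?S \<subseteq> case_prod (multiplicity G) ` (verts G \<times> verts G)" by auto
  then have "finite ?S" using multigraphD(1)[OF assms(1)] by (meson finite_SigmaI finite_imageI finite_subset)
  moreover have "?S \<noteq> {}"
  proof -
    obtain u where u: "u \<in> verts G" using assms(2) unfolding num_verts_def by fastforce
    have "\<not> verts G \<subseteq> {u}"
      using assms(2) card_mono[of "{u}" "verts G"] unfolding num_verts_def by auto
    then obtain v where "v \<in> verts G" "u \<noteq> v" by blast
    with u show ?thesis by blast
  qed
  ultimately have "max_multiplicity G \<le> k \<longleftrightarrow> (\<forall>x\<in>?S. x \<le> k)"
    unfolding max_multiplicity_def by (rule Max_le_iff)
  also have "\<dots> \<longleftrightarrow> (\<forall>e. count (edges G) e \<le> k)"
  proof
    assume S: "\<forall>x\<in>?S. x \<le> k"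
    show "\<forall>e. count (edges G) e \<le> k"
    proof
      fix e
      show "count (edges G) e \<le> k"
      proof (cases "e \<in># edges G")
        case True
        then obtain u v where "e = {u, v}" "u \<noteq> v"
          using multigraphD(3)[OF assms(1) True] unfolding card_2_iff by blast
        moreover from this have "multiplicity G u v \<in> ?S"
          using multigraphD(2)[OF assms(1) True] by blast
        ultimately show ?thesis using S unfolding multiplicity_def by blast
      qed (simp add: not_in_iff)
    qed
  qed (auto simp: multiplicity_def)
  finally show ?thesis .
qed

section \<open>Cuts versus minimum degree, and the cases of two and three vertices\<close>

lemma min_degree_ge_4:
  assumes "multigraph G" "2 \<le> num_verts G"
    and "\<forall>X. X \<noteq> {} \<longrightarrow> X \<subset> verts G \<longrightarrow> 4 \<le> cut_degree G X"
  shows "4 \<le> min_degree G"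
proof -
  have "verts G \<noteq> {v}" for v
    using assms(2) unfolding num_verts_def by auto
  then have "{v} \<subset> verts G" if "v \<in> verts G" for v
    using that by blast
  moreover have "verts G \<noteq> {}" using assms(2) unfolding num_verts_def by auto
  ultimately show ?thesis
    using assms(3) by (subst min_degree_ge_iff[OF assms(1)]) (simp_all add: vdegree_eq_cut_degree)
qed

text \<open>One side of the cut is a single vertex, and both sides have the same cut degree.\<close>

lemma cut_degree_ge_min_degree:
  assumes G: "multigraph G" and X: "X \<noteq> {}" "X \<subset> verts G"
    and "card X = 1 \<or> card (verts G - X) = 1"
  shows "min_degree G \<le> cut_degree G X"
proof -
  have V: "verts G \<noteq> {}" using X by blast
  have "min_degree G \<le> cut_degree G {v}" if "v \<in> verts G" for v
    using min_degree_ge_iff[OF G V, of "min_degree G"] that by (simp add: vdegree_eq_cut_degree)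
  then have *: "min_degree G \<le> cut_degree G Y" if "card Y = 1" "Y \<subseteq> verts G" for Y
    using that by (metis card_1_singletonE insert_subset)
  show ?thesis
    using assms(4) *[of X] *[of "verts G - X"] cut_degree_split(2)[OF G X] X by auto
qed

text \<open>Meant for two and three vertices, where every cut isolates a vertex; four vertices also
  admit cuts into two pairs.\<close>

lemma cut_degrees_ge_4_iff:
  assumes "multigraph G" "2 \<le> num_verts G"
    and "\<And>X. X \<noteq> {} \<Longrightarrow> X \<subset> verts G \<Longrightarrow> card X = 1 \<or> card (verts G - X) = 1"
  shows "(\<forall>X. X \<noteq> {} \<longrightarrow> X \<subset> verts G \<longrightarrow> 4 \<le> cut_degree G X) \<longleftrightarrow> 4 \<le> min_degree G"
proof
  assume min: "4 \<le> min_degree G"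
  show "\<forall>X. X \<noteq> {} \<longrightarrow> X \<subset> verts G \<longrightarrow> 4 \<le> cut_degree G X"
  proof (intro allI impI)
    fix X assume X: "X \<noteq> {}" "X \<subset> verts G"
    show "4 \<le> cut_degree G X"
      using min cut_degree_ge_min_degree[OF assms(1) X assms(3)[OF X]] by linarith
  qed
qed (rule min_degree_ge_4[OF assms(1,2)])

lemma S5_contractible_2:
  assumes G: "multigraph G" and n: "num_verts G = 2"
  shows "S5_contractible G \<longleftrightarrow> 4 \<le> num_edges G"
proof -
  have V: "verts G \<noteq> {}" using n by (auto simp: num_verts_def)
  have "min_degree G = num_edges G"
    unfolding min_degree_def using vdegree_two_vertices[OF G n] V by (simp add: image_constant_conv)
  moreover have "card X = 1" if "X \<noteq> {}" "X \<subset> verts G" for X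
    using that n psubset_card_mono[OF multigraphD(1)[OF G] that(2)] multigraphD(1)[OF G]
    unfolding num_verts_def by (metis One_nat_def card_0_eq finite_subset less_2_cases psubset_imp_subset)
  ultimately have cuts: "(\<forall>X. X \<noteq> {} \<longrightarrow> X \<subset> verts G \<longrightarrow> 4 \<le> cut_degree G X) \<longleftrightarrow> 4 \<le> num_edges G"
    using cut_degrees_ge_4_iff[OF G] n by simp
  \<comment> \<open>Two vertices admit no three parts, so the condition on triples is
    vacuous.\<close>
  have "card P \<noteq> 3" if "partition_on (verts G) P" for P
    using partition_card_le[OF multigraphD(1)[OF G] that] n unfolding num_verts_def by auto
  then show ?thesis
    using S5_contractible_iff[OF G] n cuts by simp
qed

lemma S5_contractible_3:
  assumes G: "multigraph G" and n: "num_verts G = 3"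
  shows "S5_contractible G \<longleftrightarrow> 8 \<le> num_edges G \<and> 4 \<le> min_degree G"
proof -
  note fin = multigraphD(1)[OF G]
  have "card X = 1 \<or> card (verts G - X) = 1" if "X \<noteq> {}" "X \<subset> verts G" for X
  proof -
    have "finite X" using that(2) fin finite_subset by blast
    then have "card X \<noteq> 0" using that(1) by simp
    then show ?thesis
      using card_Diff_subset[OF \<open>finite X\<close>, of "verts G"] psubset_card_mono[OF fin that(2)] that(2) n
      unfolding num_verts_def by auto
  qed
  then have cuts: "(\<forall>X. X \<noteq> {} \<longrightarrow> X \<subset> verts G \<longrightarrow> 4 \<le> cut_degree G X) \<longleftrightarrow> 4 \<le> min_degree G"
    using cut_degrees_ge_4_iff[OF G] n by simp
  let ?P = "(\<lambda>v. {v}) ` verts G"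
  \<comment> \<open>The only partition into three parts is the trivial one, so the condition on
    triples bounds the edges of \<open>G\<close> itself.\<close>
  have "partition_on (verts G) P \<and> card P = 3 \<longleftrightarrow> P = ?P" for P
    using partition_card_eq[OF fin, of P] n partition_on_singletons[of "verts G"]
    unfolding num_verts_def by (auto simp: card_image)
  moreover have "num_edges (contract G ?P) = num_edges G"
    using isomorphic_num_edges[OF isomorphic_contract_singletons[OF G]] by simp
  ultimately have "(\<forall>P. partition_on (verts G) P \<longrightarrow> card P = 3 \<longrightarrow> 8 \<le> num_edges (contract G P))
      \<longleftrightarrow> 8 \<le> num_edges G" by metis
  then show ?thesis
    using S5_contractible_iff[OF G] n cuts by auto
qed

section \<open>Explicit edge counts on four vertices\<close>

text \<open>Everything becomes linear in the six multiplicities, so that later bounds are linear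
  arithmetic. The three cuts into pairs are indexed by the partner of \<open>a\<close>.\<close>

lemma four_vertices:
  assumes G: "multigraph G" "verts G = {a, b, c, d}" and dist: "distinct [a, b, c, d]"
  defines "m \<equiv> \<lambda>u v. count (edges G) {u, v}"
  shows "num_edges G = m a b + m a c + m a d + m b c + m b d + m c d"
    and "vdegree G a = m a b + m a c + m a d"
    and "vdegree G b = m a b + m b c + m b d"
    and "vdegree G c = m a c + m b c + m c d"
    and "vdegree G d = m a d + m b d + m c d"
    and "cut_degree G {a, b} = m a c + m a d + m b c + m b d"
    and "cut_degree G {a, c} = m a b + m a d + m b c + m c d"
    and "cut_degree G {a, d} = m a b + m a c + m b d + m c d"
proof -
  let ?A = "{{a, b}, {a, c}, {a, d}, {b, c}, {b, d}, {c, d}}"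
  have "e \<in> ?A" if e: "e \<in># edges G" for e
  proof -
    obtain x y where xy: "e = {x, y}" "x \<noteq> y"
      using multigraphD(3)[OF G(1) e] unfolding card_2_iff by blast
    have "x \<in> {a, b, c, d}" "y \<in> {a, b, c, d}"
      using multigraphD(2)[OF G(1) e] unfolding G(2) xy(1) by blast+
    with xy(2) show ?thesis unfolding xy(1) by (auto simp: doubleton_eq_iff)
  qed
  then have sub: "set_mset (edges G) \<subseteq> ?A" by (rule subsetI)
  \<comment> \<open>One formula for arbitrary \<open>Q\<close> yields all the counts:
    \<open>Q\<close> is then taken to be constantly true, incidence with a vertex, or crossing a
    cut.\<close>
  have "size (filter_mset Q (edges G)) = (\<Sum>e\<in>?A. if Q e then count (edges G) e else 0)" for Q
    by (rule size_filter_mset_sum[OF _ sub]) simp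
  then have S: "size (filter_mset Q (edges G)) =
      (if Q {a, b} then m a b else 0) + (if Q {a, c} then m a c else 0) +
      (if Q {a, d} then m a d else 0) + (if Q {b, c} then m b c else 0) +
      (if Q {b, d} then m b d else 0) + (if Q {c, d} then m c d else 0)" for Q
    using dist unfolding m_def by (simp add: doubleton_eq_iff add.assoc)
  show "num_edges G = m a b + m a c + m a d + m b c + m b d + m c d"
    using S[of "\<lambda>_. True"] unfolding num_edges_def by simp
  show "vdegree G a = m a b + m a c + m a d" "vdegree G b = m a b + m b c + m b d"
    "vdegree G c = m a c + m b c + m c d" "vdegree G d = m a d + m b d + m c d"
    using dist unfolding vdegree_def S by auto
  show "cut_degree G {a, b} = m a c + m a d + m b c + m b d"
    "cut_degree G {a, c} = m a b + m a d + m b c + m c d"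
    "cut_degree G {a, d} = m a b + m a c + m b d + m c d"
    using dist unfolding cut_degree_def S by (auto simp: Int_insert_left)
qed

lemma num_edges_contract_pair:
  assumes G: "multigraph G" "verts G = {a, b, c, d}" and dist: "distinct [a, b, c, d]"
  shows "partition_on (verts G) {{a, b}, {c}, {d}}" "card {{a, b}, {c}, {d}} = 3"
    and "num_edges G = num_edges (contract G {{a, b}, {c}, {d}}) + count (edges G) {a, b}"
proof -
  show P: "partition_on (verts G) {{a, b}, {c}, {d}}"
    using dist unfolding G(2) partition_on_def disjoint_def by auto
  show "card {{a, b}, {c}, {d}} = 3"
    using dist by (auto simp: card_insert_if)
  have "card X \<le> 2" if "X \<in> {{a, b}, {c}, {d}}" for X
    using that by (auto simp: card_insert_if)
  then show "num_edges G = num_edges (contract G {{a, b}, {c}, {d}}) + count (edges G) {a, b}"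
    using num_edges_contract_small_parts[OF G(1) P] dist count_edges_eq_0[OF G(1)]
    by simp
qed

section \<open>Truncating multiplicities\<close>

text \<open>Intersecting with \<open>k\<close> copies of each occurring edge replaces every
  multiplicity by its minimum with \<open>k\<close>, and the result is a submultiset of
  \<open>edges G\<close> by construction.\<close>

definition cap :: "nat \<Rightarrow> 'a mgraph \<Rightarrow> 'a mgraph" where
  "cap k G = \<lparr>verts = verts G,
     edges = edges G \<inter># repeat_mset k (mset_set (set_mset (edges G)))\<rparr>"

lemma verts_cap: "verts (cap k G) = verts G"
  and count_cap: "count (edges (cap k G)) e = min (count (edges G) e) k"
  by (simp_all add: cap_def count_mset_set' not_in_iff)

lemma spanning_subgraph_cap: "spanning_subgraph (cap k G) G"
  unfolding spanning_subgraph_def cap_def by simp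

lemma spanning_subgraph_multigraph:
  assumes "multigraph G" "spanning_subgraph H G"
  shows "multigraph H"
  using assms unfolding spanning_subgraph_def multigraph_def by (metis mset_subset_eqD)

lemma spanning_subgraph_mono:
  assumes "spanning_subgraph H G" "multigraph G"
  shows "num_edges H \<le> num_edges G"
    and "cut_degree H X \<le> cut_degree G X"
    and "partition_on (verts G) P \<Longrightarrow> num_edges (contract H P) \<le> num_edges (contract G P)"
  using assms spanning_subgraph_multigraph[OF assms(2,1)]
  unfolding spanning_subgraph_def num_edges_def[of G] num_edges_def[of H] cut_degree_def
  by (simp_all add: num_edges_contract size_mset_mono multiset_filter_mono)

text \<open>If two parallel classes have more than 4 edges, then they keep 8 edges; the remaining 4 come
  from a vertex avoided by both classes, or from the cut separating them. A single such class keeps 4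
  edges, besides the 8 edges guaranteed by contracting it.\<close>

lemma cap_4_bounds:
  assumes G: "multigraph G" and n: "num_verts G = 4"
    and cuts: "\<forall>X. X \<noteq> {} \<longrightarrow> X \<subset> verts G \<longrightarrow> 4 \<le> cut_degree G X"
    and triples: "\<forall>P. partition_on (verts G) P \<longrightarrow> card P = 3 \<longrightarrow> 8 \<le> num_edges (contract G P)"
    and "12 \<le> num_edges G"
  shows "12 \<le> num_edges (cap 4 G)" "4 \<le> min_degree (cap 4 G)"
proof -
  obtain a b c d where V: "verts G = {a, b, c, d}" and dist: "distinct [a, b, c, d]"
  proof -
    obtain xs where xs: "set xs = verts G" "distinct xs" "length xs = 4"
      using finite_distinct_list[OF multigraphD(1)[OF G]] n distinct_card
      unfolding num_verts_def by metis
    then obtain a b c d where "xs = [a, b, c, d]"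
      by (auto simp: length_Suc_conv numeral_eq_Suc)
    with xs have "verts G = {a, b, c, d}" "distinct [a, b, c, d]" by auto
    then show thesis by (rule that)
  qed
  have capG: "multigraph (cap 4 G)"
    using spanning_subgraph_multigraph[OF G spanning_subgraph_cap] .
  have capV: "verts (cap 4 G) = {a, b, c, d}" using V by (simp add: verts_cap)
  let ?m = "\<lambda>u v. count (edges G) {u, v}"
  \<comment> \<open>Contracting \<open>a\<close> and \<open>b\<close> loses exactly the edges
    between them and leaves three vertices, hence at least 8 edges.\<close>
  have pair: "8 + ?m a b \<le> num_edges G"
    if "verts G = {a, b, c, d}" "distinct [a, b, c, d]" for a b c d
    using num_edges_contract_pair[OF G that] triples by fastforce
  have pairs: "8 + ?m a b \<le> num_edges G" "8 + ?m a c \<le> num_edges G" "8 + ?m a d \<le> num_edges G"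
    "8 + ?m b c \<le> num_edges G" "8 + ?m b d \<le> num_edges G" "8 + ?m c d \<le> num_edges G"
    using pair[of a b c d] pair[of a c b d] pair[of a d b c] pair[of b c a d] pair[of b d a c]
      pair[of c d a b] V dist by (auto simp: insert_commute)
  have deg: "4 \<le> vdegree G v" if "v \<in> verts G" for v
    using cuts[rule_format, of "{v}"] that V dist by (auto simp: vdegree_eq_cut_degree)
  have "{a, b} \<subset> verts G" "{a, c} \<subset> verts G" "{a, d} \<subset> verts G"
    using dist unfolding V by auto
  then have cut: "4 \<le> cut_degree G {a, b}" "4 \<le> cut_degree G {a, c}" "4 \<le> cut_degree G {a, d}"
    using cuts by simp_all
  note uncapped = four_vertices[OF G V dist]
  note capped = four_vertices[OF capG capV dist, unfolded count_cap]
  have degs: "4 \<le> vdegree G a" "4 \<le> vdegree G b" "4 \<le> vdegree G c" "4 \<le> vdegree G d"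
    using deg V by auto
  show "12 \<le> num_edges (cap 4 G)"
    using pairs cut degs assms(5) unfolding uncapped capped by linarith
  \<comment> \<open>A truncated class at a vertex alone gives degree 4; if no class there is
    truncated, the degree is unchanged.\<close>
  have "4 \<le> vdegree (cap 4 G) a" "4 \<le> vdegree (cap 4 G) b" "4 \<le> vdegree (cap 4 G) c"
    "4 \<le> vdegree (cap 4 G) d"
    using degs unfolding uncapped capped by linarith+
  then show "4 \<le> min_degree (cap 4 G)"
    using capV by (subst min_degree_ge_iff[OF capG]) auto
qed

lemma spanning_subgraph_eqI:
  assumes "spanning_subgraph H G" "edges H = edges G"
  shows "H = G"
  using assms unfolding spanning_subgraph_def by simp

text \<open>A multiplicity that was truncated would equal 4, but those of \<open>W1\<close> and
  \<open>W2\<close> are at most 3. So nothing was truncated.\<close>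

lemma cap_eq_if_isomorphic_W:
  assumes "isomorphic (cap 4 G) W1 \<or> isomorphic (cap 4 G) W2"
  shows "cap 4 G = G"
proof (rule spanning_subgraph_eqI[OF spanning_subgraph_cap])
  have "count (edges (cap 4 G)) e \<le> 3" for e
    using assms isomorphic_count_le[of "cap 4 G" _ e] count_W_le le_trans by metis
  then have "min (count (edges G) e) 4 \<le> 3" for e
    unfolding count_cap .
  then have "count (edges (cap 4 G)) e = count (edges G) e" for e
    unfolding count_cap by (metis min_def numeral_le_iff semiring_norm(69) semiring_norm(72))
  then show "edges (cap 4 G) = edges G" by (rule multiset_eqI)
qed

lemma S5_contractible_4:
  assumes G: "multigraph G" and n: "num_verts G = 4"
  shows "S5_contractible G \<longleftrightarrow>
    (\<exists>G'. spanning_subgraph G' G \<and> num_edges G' \<ge> 12 \<and> min_degree G' \<ge> 4 \<and>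
          max_multiplicity G' \<le> 4 \<and> \<not> isomorphic G' W1 \<and> \<not> isomorphic G' W2)"
proof
  assume "S5_contractible G"
  then have *: "\<forall>X. X \<noteq> {} \<longrightarrow> X \<subset> verts G \<longrightarrow> 4 \<le> cut_degree G X"
    "\<forall>P. partition_on (verts G) P \<longrightarrow> card P = 3 \<longrightarrow> 8 \<le> num_edges (contract G P)"
    "12 \<le> num_edges G" "\<not> isomorphic G W1" "\<not> isomorphic G W2"
    using S5_contractible_iff[OF G] n by simp_all
  have "max_multiplicity (cap 4 G) \<le> 4"
    using n by (subst max_multiplicity_le_iff[OF spanning_subgraph_multigraph[OF G spanning_subgraph_cap]])
      (simp_all add: count_cap num_verts_def verts_cap)
  moreover have "\<not> isomorphic (cap 4 G) W1 \<and> \<not> isomorphic (cap 4 G) W2"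
    using cap_eq_if_isomorphic_W[of G] *(4,5) by auto
  ultimately show "\<exists>G'. spanning_subgraph G' G \<and> num_edges G' \<ge> 12 \<and> min_degree G' \<ge> 4 \<and>
          max_multiplicity G' \<le> 4 \<and> \<not> isomorphic G' W1 \<and> \<not> isomorphic G' W2"
    using spanning_subgraph_cap cap_4_bounds[OF G n *(1-3)] by blast
next
  assume "\<exists>G'. spanning_subgraph G' G \<and> num_edges G' \<ge> 12 \<and> min_degree G' \<ge> 4 \<and>
          max_multiplicity G' \<le> 4 \<and> \<not> isomorphic G' W1 \<and> \<not> isomorphic G' W2"
  then obtain H where H: "spanning_subgraph H G" "12 \<le> num_edges H" "4 \<le> min_degree H"
    "max_multiplicity H \<le> 4" and notW: "\<not> isomorphic H W1" "\<not> isomorphic H W2" by blast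
  have mH: "multigraph H" using spanning_subgraph_multigraph[OF G H(1)] .
  have VH: "verts H = verts G" using H(1) by (simp add: spanning_subgraph_def)
  note fin = multigraphD(1)[OF G]
  have mult: "count (edges H) e \<le> 4" for e
    using max_multiplicity_le_iff[OF mH] H(4) n by (simp add: num_verts_def VH)
  have card4: "card (verts G) = 4" using n by (simp add: num_verts_def)
  have cuts: "4 \<le> cut_degree G X" if X: "X \<noteq> {}" "X \<subset> verts G" for X
  proof -
    have finX: "finite X" using X(2) fin finite_subset by blast
    have "card X \<noteq> 0" "card X < 4"
      using finX X psubset_card_mono[OF fin X(2)] card4 by auto
    moreover have diff: "card (verts G - X) = 4 - card X"
      using card_Diff_subset[OF finX] X(2) card4 by auto
    ultimately consider "card X = 1 \<or> card (verts G - X) = 1" | "card X = 2" by linarith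
    then have "4 \<le> cut_degree H X"
    proof cases
      case 1
      then show ?thesis
        using cut_degree_ge_min_degree[OF mH X(1)] X(2) H(3) by (simp add: VH)
    next
      case 2
      \<comment> \<open>Edges that do not cross the cut lie inside one of the two pairs, at most 4
        in each, so at least 4 of the 12 cross.\<close>
      let ?P = "{X, verts G - X}"
      note P = partition_split[OF X]
      have "card Y \<le> 2" if "Y \<in> ?P" for Y
        using that diff 2 by auto
      then have "num_edges H = num_edges (contract H ?P) + (\<Sum>Y\<in>?P. count (edges H) Y)"
        by (rule num_edges_contract_small_parts[OF mH, unfolded VH, OF P(1)])
      moreover have "num_edges (contract H ?P) = cut_degree H X"
        using cut_degree_split(1)[OF mH X(1)] X(2) by (simp add: VH)
      moreover have "(\<Sum>Y\<in>?P. count (edges H) Y) \<le> (\<Sum>Y\<in>?P. 4)"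
        using mult by (intro sum_mono)
      ultimately show ?thesis using H(2) P(2) by simp
    qed
    then show ?thesis using spanning_subgraph_mono(2)[OF H(1) G] le_trans by blast
  qed
  have triples: "8 \<le> num_edges (contract G P)" if P: "partition_on (verts G) P" "card P = 3" for P
  proof -
    obtain X Y Z where XYZ: "P = {X, Y, Z}" "X \<noteq> Y" "Y \<noteq> Z" "X \<noteq> Z"
      using P(2) unfolding card_3_iff by blast
    have "card X + card Y + card Z = 4"
      using partition_card_sum[OF fin P(1)] card4 XYZ by simp
    moreover have "1 \<le> card X" "1 \<le> card Y" "1 \<le> card Z"
      using partition_part(3)[OF fin P(1)] XYZ(1) by simp_all
    \<comment> \<open>Four vertices in three nonempty parts have sizes 2, 1, 1 in some order, so
      contraction loses a single parallel class, at most 4 of the 12 edges.\<close>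
    ultimately have cards: "card X = 2 \<and> card Y = 1 \<and> card Z = 1 \<or>
        card X = 1 \<and> card Y = 2 \<and> card Z = 1 \<or> card X = 1 \<and> card Y = 1 \<and> card Z = 2"
      by linarith
    have "card W \<le> 2" if "W \<in> P" for W using that cards XYZ(1) by auto
    then have "num_edges H = num_edges (contract H P) + (\<Sum>W\<in>P. count (edges H) W)"
      using P(1) by (intro num_edges_contract_small_parts[OF mH]) (simp_all add: VH)
    moreover have "(\<Sum>W\<in>P. count (edges H) W) \<le> 4"
      using cards XYZ mult count_edges_eq_0[OF mH] by auto
    ultimately have "8 \<le> num_edges (contract H P)" using H(2) by simp
    then show ?thesis using spanning_subgraph_mono(3)[OF H(1) G P(1)] by simp
  qed
  \<comment> \<open>If \<open>G\<close> were \<open>W1\<close> or \<open>W2\<close>, it would have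
    just the 12 edges that \<open>H\<close> already has; then \<open>H\<close> would be
    \<open>G\<close>, contrary to the choice of \<open>H\<close>.\<close>
  have "H = G" if "num_edges G = 12"
  proof (rule spanning_subgraph_eqI[OF H(1)])
    have "edges H \<subseteq># edges G" using H(1) by (simp add: spanning_subgraph_def)
    then show "edges H = edges G"
      using mset_subset_size[of "edges H" "edges G"] H(2) that
      unfolding num_edges_def subset_mset.less_le by linarith
  qed
  moreover have "num_edges G = 12" if "isomorphic G W1 \<or> isomorphic G W2"
    using that isomorphic_num_edges[of G] W_stats(3,4) by metis
  ultimately have "\<not> isomorphic G W1 \<and> \<not> isomorphic G W2" using notW by blast
  then show "S5_contractible G"
    using S5_contractible_iff[OF G] n cuts triples spanning_subgraph_mono(1)[OF H(1) G] H(2) by simp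
qed

theorem theorem2p3:
  fixes G :: "'a mgraph"
  assumes "multigraph G" and "num_verts G \<le> 4"
  shows
    "(S5_contractible G \<longleftrightarrow>
        (num_verts G = 2 \<and> num_edges G \<ge> 4) \<or>
        (num_verts G = 3 \<and> num_edges G \<ge> 8 \<and> min_degree G \<ge> 4) \<or>
        (num_verts G = 4 \<and>
           (\<exists>G'. spanning_subgraph G' G \<and> num_edges G' \<ge> 12 \<and> min_degree G' \<ge> 4 \<and>
                 max_multiplicity G' \<le> 4 \<and> \<not> isomorphic G' W1 \<and> \<not> isomorphic G' W2))) \<and>
     ((num_verts G = 2 \<and> num_edges G \<ge> 4) \<longleftrightarrow>
        (\<exists>a \<ge> 4. isomorphic G (multi_K2 a))) \<and>
     ((num_verts G = 3 \<and> num_edges G \<ge> 8 \<and> min_degree G \<ge> 4) \<longleftrightarrow>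
        (\<exists>a b c. isomorphic G (multi_triangle a b c) \<and>
           a + b + c \<ge> 8 \<and> Min {a + b, a + c, b + c} \<ge> 4))"
proof (intro conjI)
  have ge2: "S5_contractible G \<Longrightarrow> 2 \<le> num_verts G" unfolding S5_contractible_def by blast
  \<comment> \<open>Below two vertices both sides fail: contractibility requires two, and each
    alternative fixes a larger number.\<close>
  consider "num_verts G < 2" | "num_verts G = 2" | "num_verts G = 3" | "num_verts G = 4"
    using assms(2) by linarith
  then show "S5_contractible G \<longleftrightarrow>
        (num_verts G = 2 \<and> num_edges G \<ge> 4) \<or>
        (num_verts G = 3 \<and> num_edges G \<ge> 8 \<and> min_degree G \<ge> 4) \<or>
        (num_verts G = 4 \<and>
           (\<exists>G'. spanning_subgraph G' G \<and> num_edges G' \<ge> 12 \<and> min_degree G' \<ge> 4 \<and>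
                 max_multiplicity G' \<le> 4 \<and> \<not> isomorphic G' W1 \<and> \<not> isomorphic G' W2))"
  proof cases
    case 1
    then show ?thesis using ge2 by auto
  next
    case 2
    then show ?thesis using S5_contractible_2[OF assms(1)] by simp
  next
    case 3
    then show ?thesis using S5_contractible_3[OF assms(1)] by simp
  next
    case 4
    then show ?thesis using S5_contractible_4[OF assms(1)] by simp
  qed
  show "(num_verts G = 2 \<and> num_edges G \<ge> 4) \<longleftrightarrow> (\<exists>a \<ge> 4. isomorphic G (multi_K2 a))"
    using isomorphic_multi_K2[OF assms(1)] isomorphic_num_verts[of G] isomorphic_num_edges[of G]
    by (metis multi_K2_stats)
  have "num_verts G = 3" "num_edges G = a + b + c" "min_degree G = Min {a + b, a + c, b + c}"
    if "isomorphic G (multi_triangle a b c)" for a b c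
    using isomorphic_num_verts[OF that] isomorphic_num_edges[OF that]
      isomorphic_min_degree[OF assms(1) that] multi_triangle_stats[of a b c] by simp_all
  then show "(num_verts G = 3 \<and> num_edges G \<ge> 8 \<and> min_degree G \<ge> 4) \<longleftrightarrow>
        (\<exists>a b c. isomorphic G (multi_triangle a b c) \<and>
           a + b + c \<ge> 8 \<and> Min {a + b, a + c, b + c} \<ge> 4)"
    using isomorphic_multi_triangle[OF assms(1)] by metis
qed

end
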